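(* Let $a,s,t$ be integers with $0\le a<s\le t$ and $s,t$ coprime. Then \[ \bigl|\mathcal{C}_{(s|0,a)}\cap\mathcal{C}_{(t|0,a)}\bigr|=\frac{(s+t-a-1)!}{a!\,(s-a)!\,(t-a)!}. \]
   Context: A partition is a weakly decreasing sequence of non-negative integers with finite sum; a bipartition is a pair $(\lambda,\mu)$ of partitions, with nodes $(a,b,1)$ for $b\le\lambda_a$ and $(a,b,2)$ for $b\le\mu_a$. For $s\ge0$ and $c=(c_1,c_2)\in\mathbb{Z}^2$, the $(s\,|\,c)$-residue of a node $(a,b,k)$ is $b-a+c_k+s\mathbb{Z}$, and the $(s\,|\,c)$-content of a bipartition is the multiset of residues of its nodes. A bipartition is an $(s\,|\,c)$-core if no other bipartition has the same $(s\,|\,c)$-content, except that for $s=1$ the only $(1\,|\,c)$-core is defined to be $(\varnothing,\varnothing)$; $\mathcal{C}_{(s|c_1,c_2)}$ is the set of such cores. *)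

theory Defs
  imports Complex_Main "HOL-Library.Multiset"
begin

text \<open>
  A partition \<open>\<lambda>\<^sub>1 \<ge> \<lambda>\<^sub>2 \<ge> \<dots>\<close> is a function \<open>lam :: nat \<Rightarrow> nat\<close> with \<open>lam i\<close> standing for
  \<open>\<lambda>\<^sub>i\<^sub>+\<^sub>1\<close> (positions are shifted to start at 0). For non-negative integers, having finite sum means
  having only finitely many non-zero terms.
\<close>

type_synonym bipartition = "(nat \<Rightarrow> nat) \<times> (nat \<Rightarrow> nat)"

definition is_partition :: "(nat \<Rightarrow> nat) \<Rightarrow> bool" where
  "is_partition lam \<longleftrightarrow> antimono lam \<and> finite {i. lam i \<noteq> 0}"

definition is_bipartition :: "bipartition \<Rightarrow> bool" where
  "is_bipartition bp \<longleftrightarrow> is_partition (fst bp) \<and> is_partition (snd bp)"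

definition empty_partition :: "nat \<Rightarrow> nat" where
  "empty_partition = (\<lambda>_. 0)"

text \<open>Nodes \<open>(a, b, k)\<close> have \<open>a, b \<ge> 1\<close> and \<open>k \<in> {1, 2}\<close>; row \<open>a = Suc i\<close> has length \<open>lam i\<close>.\<close>

definition nodes :: "bipartition \<Rightarrow> (nat \<times> nat \<times> nat) set" where
  "nodes bp =
     {(Suc i, b, 1) | i b. 1 \<le> b \<and> b \<le> fst bp i} \<union>
     {(Suc i, b, 2) | i b. 1 \<le> b \<and> b \<le> snd bp i}"

text \<open>The residue is the coset \<open>b - a + c\<^sub>k + s\<int>\<close>, a singleton if \<open>s = 0\<close>.\<close>

definition residue :: "nat \<Rightarrow> int \<times> int \<Rightarrow> nat \<times> nat \<times> nat \<Rightarrow> int set" where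
  "residue s c = (\<lambda>(a, b, k).
     {int b - int a + (if k = 1 then fst c else snd c) + int s * m | m. True})"

text \<open>
  \<^const>\<open>mset_set\<close> yields the empty multiset on infinite sets; \<open>finite_nodes\<close> below shows that this
  does not happen for bipartitions.
\<close>

definition content :: "nat \<Rightarrow> int \<times> int \<Rightarrow> bipartition \<Rightarrow> int set multiset" where
  "content s c bp = image_mset (residue s c) (mset_set (nodes bp))"

definition is_core :: "nat \<Rightarrow> int \<times> int \<Rightarrow> bipartition \<Rightarrow> bool" where
  "is_core s c bp \<longleftrightarrow>
     is_bipartition bp \<and>
     (if s = 1 then bp = (empty_partition, empty_partition)
      else \<forall>bp'. is_bipartition bp' \<and> content s c bp' = content s c bp \<longrightarrow> bp' = bp)"

definition cores :: "nat \<Rightarrow> int \<times> int \<Rightarrow> bipartition set" where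
  "cores s c = {bp. is_core s c bp}"

lemma finite_nodes:
  assumes "is_bipartition bp"
  shows "finite (nodes bp)"
proof -
  have *: "finite {(Suc i, b, k) | i b. 1 \<le> b \<and> b \<le> lam i}"
    if "is_partition lam" for lam and k :: nat
  proof (rule finite_subset)
    show "{(Suc i, b, k) | i b. 1 \<le> b \<and> b \<le> lam i}
            \<subseteq> (\<lambda>(i, b). (Suc i, b, k)) ` (SIGMA i : {i. lam i \<noteq> 0}. {..lam i})"
      by force
    show "finite ((\<lambda>(i, b). (Suc i, b, k)) ` (SIGMA i : {i. lam i \<noteq> 0}. {..lam i}))"
      using that by (auto simp: is_partition_def)
  qed
  show ?thesis
    using assms unfolding nodes_def is_bipartition_def by (blast intro: * finite_UnI)
qed

end

theory Submission
  imports Defs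
begin

text \<open>
  Encode \<open>(\<lambda>, \<mu>)\<close> by the bead sets \<open>X = {\<lambda>\<^sub>i - i}\<close> and
  \<open>Y = {\<mu>\<^sub>i - i + a}\<close>. For \<open>0 \<le> a < s\<close> the bipartition is an \<open>(s|0,a)\<close>-core iff
  \<open>Y - s \<subseteq> X \<subseteq> Y\<close>: any other pair admits a content-preserving bead move, and a convexity
  argument shows that a pair of this shape is the only one with its content. So the simultaneous
  cores are the pairs with \<open>Y - s \<subseteq> X \<subseteq> Y\<close> and \<open>Y - t \<subseteq> X\<close> in which \<open>X\<close> has charge \<open>0\<close> and \<open>Y\<close>
  has charge \<open>a\<close>. Let \<open>y\<^sub>j\<close> be the greatest element of \<open>Y\<close> congruent to \<open>j t\<close> modulo \<open>s\<close>, and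
  \<open>A\<close> the set of the \<open>j < s\<close> with \<open>y\<^sub>j \<notin> X\<close>. The condition for \<open>t\<close> says that
  \<open>y\<^sub>j + t - y\<^sub>j\<^sub>+\<^sub>1 = s (l\<^sub>j + [j \<in> A])\<close> with \<open>l\<^sub>j \<ge> 0\<close>, and \<open>\<Sum> l\<^sub>j = t - a\<close>. Up to translation by
  multiples of \<open>s\<close> the pairs of arbitrary charge therefore correspond to the \<open>s choose a\<close> sets \<open>A\<close>
  and the \<open>(s + t - a - 1) choose (t - a)\<close> compositions \<open>l\<close>; exactly one in \<open>s\<close> of these classes
  contains a pair whose \<open>X\<close> has charge \<open>0\<close>.
\<close>

subsection \<open>Bead sets of partitions\<close>

text \<open>Rows are numbered from 0, hence the \<open>- 1\<close>: the empty partition gives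
  \<open>{..<c}\<close>, of charge \<open>c\<close>.\<close>

definition beads :: "int \<Rightarrow> (nat \<Rightarrow> nat) \<Rightarrow> int set" where
  "beads c lam = range (\<lambda>i. int (lam i) - int i - 1 + c)"

definition bead_set :: "int set \<Rightarrow> bool" where
  "bead_set X \<longleftrightarrow> (\<exists>l. {..<l} \<subseteq> X) \<and> (\<exists>u. X \<subseteq> {..<u})"

text \<open>
  The sum of \<open>g\<close> over \<open>X\<close>, regularised by subtracting its sum over all negative integers; both sums
  below are finite for a \<open>bead_set\<close>.
\<close>
definition dev :: "(int \<Rightarrow> int) \<Rightarrow> int set \<Rightarrow> int" where
  "dev g X = sum g (X \<inter> {0..}) - sum g ({..<0} - X)"

abbreviation charge :: "int set \<Rightarrow> int" where
  "charge X \<equiv> dev (\<lambda>_. 1) X"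

lemma finite_bead_set_diff:
  assumes "bead_set X" "bead_set Y"
  shows "finite (X - Y)"
proof -
  obtain l u where "{..<l} \<subseteq> Y" "X \<subseteq> {..<u}"
    using assms unfolding bead_set_def by blast
  then have "X - Y \<subseteq> {l..<u}" by (auto simp: subset_iff not_less[symmetric])
  then show ?thesis using finite_subset by blast
qed

lemma bead_set_lessThan: "bead_set {..<c}"
  unfolding bead_set_def by blast

lemma bead_set_insert: "bead_set X \<Longrightarrow> bead_set (insert x X)"
  unfolding bead_set_def
  by (metis insert_subset lessThan_iff lessThan_subset_iff linorder_le_cases order_trans
      subset_insertI subset_trans zless_add1_eq order_le_less)

lemma bead_set_remove:
  assumes "bead_set X"
  shows "bead_set (X - {x})"
proof -
  obtain l u where "{..<l} \<subseteq> X" "X \<subseteq> {..<u}" using assms unfolding bead_set_def by blast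
  then have "{..<min l x} \<subseteq> X - {x}" "X - {x} \<subseteq> {..<u}" by auto
  then show ?thesis unfolding bead_set_def by blast
qed

lemma sum_diff_eq_sum_of_bool:
  fixes g :: "'a \<Rightarrow> int"
  assumes "finite Z" "X - Y \<subseteq> Z" "Y - X \<subseteq> Z"
  shows "sum g (Y - X) - sum g (X - Y)
       = (\<Sum>x\<in>Z. g x * (of_bool (x \<in> Y) - of_bool (x \<in> X)))"
proof -
  have "sum g (Y - X) = (\<Sum>x\<in>Z. g x * of_bool (x \<in> Y - X))"
    using assms by (intro sum.mono_neutral_cong_left) auto
  moreover have "sum g (X - Y) = (\<Sum>x\<in>Z. g x * of_bool (x \<in> X - Y))"
    using assms by (intro sum.mono_neutral_cong_left) auto
  moreover have "(\<Sum>x\<in>Z. g x * of_bool (x \<in> Y - X)) - (\<Sum>x\<in>Z. g x * of_bool (x \<in> X - Y))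
       = (\<Sum>x\<in>Z. g x * (of_bool (x \<in> Y) - of_bool (x \<in> X)))"
    unfolding sum_subtractf[symmetric] by (intro sum.cong) auto
  ultimately show ?thesis by simp
qed

text \<open>The finite set \<open>W\<close> contains all places where \<open>X\<close> or
  \<open>Y\<close> differs from \<open>{..<0}\<close>. Both regularised sums become sums over
  \<open>W\<close>, and the baseline \<open>{..<0}\<close> cancels.\<close>

lemma dev_diff_of_bool:
  assumes "bead_set X" "bead_set Y" and Z: "finite Z" "X - Y \<subseteq> Z" "Y - X \<subseteq> Z"
  shows "dev g Y - dev g X = (\<Sum>x\<in>Z. g x * (of_bool (x \<in> Y) - of_bool (x \<in> X)))"
proof -
  define W where "W = Z \<union> (X - {..<0}) \<union> (Y - {..<0}) \<union> ({..<0} - X) \<union> ({..<0} - Y)"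
  have finW: "finite W"
    unfolding W_def using assms finite_bead_set_diff bead_set_lessThan by blast
  have dev: "dev g V = (\<Sum>x\<in>W. g x * (of_bool (x \<in> V) - of_bool (x \<in> {..<0})))"
    if "V - {..<0} \<subseteq> W" "{..<0} - V \<subseteq> W" for V
  proof -
    have "V \<inter> {0..} = V - {..<0}" by auto
    then show ?thesis
      unfolding dev_def using sum_diff_eq_sum_of_bool[OF finW, of "{..<0}" V g] that by simp
  qed
  have "dev g X = (\<Sum>x\<in>W. g x * (of_bool (x \<in> X) - of_bool (x \<in> {..<0})))"
    "dev g Y = (\<Sum>x\<in>W. g x * (of_bool (x \<in> Y) - of_bool (x \<in> {..<0})))"
    by (intro dev; auto simp: W_def)+
  then have "dev g Y - dev g X = (\<Sum>x\<in>W. g x * (of_bool (x \<in> Y) - of_bool (x \<in> X)))"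
    by (simp only: sum_subtractf[symmetric] right_diff_distrib) simp
  also have "\<dots> = (\<Sum>x\<in>Z. g x * (of_bool (x \<in> Y) - of_bool (x \<in> X)))"
    using finW Z by (intro sum.mono_neutral_right) (auto simp: W_def)
  finally show ?thesis .
qed

lemma dev_diff:
  assumes "bead_set X" "bead_set Y"
  shows "dev g Y - dev g X = sum g (Y - X) - sum g (X - Y)"
  using dev_diff_of_bool[OF assms, of "(X - Y) \<union> (Y - X)" g]
    sum_diff_eq_sum_of_bool[of "(X - Y) \<union> (Y - X)" X Y g]
    finite_bead_set_diff assms by simp

lemma dev_insert:
  assumes "bead_set X" "x \<notin> X"
  shows "dev g (insert x X) = dev g X + g x"
proof -
  have eq: "insert x X - X = {x}" "X - insert x X = {}" using assms by auto
  show ?thesis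
    using dev_diff[OF assms(1) bead_set_insert[OF assms(1)], of g x] unfolding eq by simp
qed

lemma dev_remove:
  assumes "bead_set X" "x \<in> X"
  shows "dev g (X - {x}) = dev g X - g x"
  using dev_insert[OF bead_set_remove[OF assms(1)], of x x g] assms(2)
  by (simp add: insert_absorb)

lemma charge_lessThan: "charge {..<c} = c"
proof -
  have "{..<c} \<inter> {0..} = {0..<c}" "{..<0} - {..<c} = {c..<0}" by auto
  then show ?thesis unfolding dev_def by simp
qed

section \<open>Correspondence between partitions and bead sets\<close>

lemma partition_eventually_0:
  assumes "is_partition lam"
  obtains n where "\<And>i. i \<ge> n \<Longrightarrow> lam i = 0"
proof -
  have "finite {i. lam i \<noteq> 0}" using assms unfolding is_partition_def by blast
  then obtain n where "\<forall>i\<in>{i. lam i \<noteq> 0}. i < n" using finite_nat_set_iff_bounded by blast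
  then show ?thesis using that by (metis (mono_tags) leD mem_Collect_eq)
qed

lemma bead_strict_antimono:
  assumes "is_partition lam" "i < j"
  shows "int (lam j) - int j < int (lam i) - int i"
proof -
  have "lam j \<le> lam i" using assms unfolding is_partition_def antimono_def by simp
  then show ?thesis using assms by linarith
qed

text \<open>The empty rows from \<open>n\<close> on have beads filling
  \<open>{..<c - int n}\<close>, which is also the lower part of \<open>{..<c}\<close>. Comparing
  both sets with this common part leaves one bead and one reference position per row
  \<open>i < n\<close>.\<close>

lemma
  assumes lam: "is_partition lam" and n: "\<And>i. i \<ge> n \<Longrightarrow> lam i = 0"
  shows bead_set_beads_aux: "bead_set (beads c lam)"
    and dev_beads: "dev g (beads c lam) - dev g {..<c}
      = (\<Sum>i<n. g (int (lam i) - int i - 1 + c) - g (c - int i - 1))"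
proof -
  let ?b = "\<lambda>i. int (lam i) - int i - 1 + c"
  let ?e = "\<lambda>i. c - int i - 1"
  have eq: "beads c lam = ?b ` {..<n} \<union> {..<c - int n}"
  proof (intro equalityI subsetI)
    fix x assume "x \<in> beads c lam"
    then obtain i where i: "x = ?b i" unfolding beads_def by blast
    then show "x \<in> ?b ` {..<n} \<union> {..<c - int n}" using n[of i] by (cases "i < n") auto
  next
    fix x assume x: "x \<in> ?b ` {..<n} \<union> {..<c - int n}"
    show "x \<in> beads c lam"
    proof (cases "x < c - int n")
      case True
      then have "x = ?b (nat (c - 1 - x))" using n[of "nat (c - 1 - x)"] by simp
      then show ?thesis unfolding beads_def by blast
    qed (use x in \<open>auto simp: beads_def\<close>)
  qed
  have eq2: "{..<c} = ?e ` {..<n} \<union> {..<c - int n}"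
  proof (intro equalityI subsetI)
    fix x assume "x \<in> {..<c}"
    then have "x = ?e (nat (c - 1 - x))" "x < c - int n \<or> nat (c - 1 - x) < n" by auto
    then show "x \<in> ?e ` {..<n} \<union> {..<c - int n}" by blast
  qed auto
  have "bead_set (?b ` {..<k} \<union> {..<c - int n})" for k
    by (induction k) (auto simp: lessThan_Suc bead_set_lessThan intro: bead_set_insert)
  then show bs: "bead_set (beads c lam)" unfolding eq .
  have inj: "inj_on ?b {..<n}"
    by (intro inj_onI) (metis bead_strict_antimono[OF lam] add_right_cancel
        linorder_neqE_nat less_irrefl diff_add_cancel)
  have inj2: "inj_on ?e {..<n}" by (intro inj_onI) simp
  have b: "beads c lam - {..<c - int n} = ?b ` {..<n}" "{..<c - int n} - beads c lam = {}"
    unfolding eq by auto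
  have "dev g (beads c lam) - dev g {..<c - int n} = (\<Sum>i<n. g (?b i))"
    using dev_diff[OF bead_set_lessThan bs, of g "c - int n"] unfolding b
    by (simp add: sum.reindex[OF inj])
  moreover have e: "{..<c} - {..<c - int n} = ?e ` {..<n}" "{..<c - int n} - {..<c} = {}"
    unfolding eq2 by auto
  have "dev g {..<c} - dev g {..<c - int n} = (\<Sum>i<n. g (?e i))"
    using dev_diff[OF bead_set_lessThan bead_set_lessThan, of g c "c - int n"] unfolding e
    by (simp add: sum.reindex[OF inj2])
  ultimately show "dev g (beads c lam) - dev g {..<c} = (\<Sum>i<n. g (?b i) - g (?e i))"
    by (simp add: sum_subtractf)
qed

lemma bead_set_beads: "is_partition lam \<Longrightarrow> bead_set (beads c lam)"
  using bead_set_beads_aux partition_eventually_0 by metis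

lemma charge_beads:
  assumes "is_partition lam"
  shows "charge (beads c lam) = c"
proof -
  obtain n where "\<And>i. i \<ge> n \<Longrightarrow> lam i = 0" using partition_eventually_0[OF assms] by blast
  from dev_beads[OF assms this, where g = "\<lambda>_. 1"] show ?thesis by (simp add: charge_lessThan)
qed

text \<open>The bead of row \<open>i\<close> is the \<open>i\<close>-th largest element, counting
  from 0, so the rows are determined one after another.\<close>

lemma beads_inject:
  assumes lam: "is_partition lam" and mu: "is_partition mu" and eq: "beads c lam = beads c mu"
  shows "lam = mu"
proof
  have le: "int (p i) \<le> int (q i)"
    if p: "is_partition p" and q: "is_partition q" and "beads c p = beads c q"
      and IH: "\<And>j. j < i \<Longrightarrow> p j = q j" for p q :: "nat \<Rightarrow> nat" and i
  proof -
    have "int (p i) - int i - 1 + c \<in> beads c q"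
      using that(3) unfolding beads_def by blast
    then obtain j where j: "int (p i) - int i = int (q j) - int j" unfolding beads_def by auto
    have "\<not> j < i" using IH[of j] bead_strict_antimono[OF p, of j i] j by auto
    then have "int (q j) - int j \<le> int (q i) - int i"
      using bead_strict_antimono[OF q, of i j] by (cases "i = j") auto
    then show ?thesis using j by simp
  qed
  show "lam i = mu i" for i
  proof (induction i rule: less_induct)
    case (less i)
    then show ?case using le[OF lam mu eq, of i] le[OF mu lam eq[symmetric], of i] by force
  qed
qed

lemma beads_zero: "beads c (\<lambda>_. 0) = {..<c}"
proof -
  have "x \<in> beads c (\<lambda>_. 0)" if "x < c" for x
    using that unfolding beads_def by (intro image_eqI[of _ _ "nat (c - 1 - x)"]) auto
  then show ?thesis unfolding beads_def by auto
qed

text \<open>A new maximum becomes a new first row. The other rows move down by one index, which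
  raising the charge by one compensates.\<close>

lemma ex_partition_beads_Un:
  fixes F :: "int set"
  assumes "finite F" "F \<subseteq> {m..}"
  shows "\<exists>lam. is_partition lam \<and> beads (m + int (card F)) lam = F \<union> {..<m}"
  using assms
proof (induction F rule: finite_linorder_max_induct)
  case empty
  have "is_partition (\<lambda>_. 0)" unfolding is_partition_def antimono_def by simp
  then show ?case using beads_zero[of m] by auto
next
  case (insert x F)
  let ?c = "m + int (card F)"
  obtain lam where lam: "is_partition lam" and F: "beads ?c lam = F \<union> {..<m}"
    using insert by auto
  have "int (lam 0) - 1 + ?c \<in> F \<union> {..<m}" unfolding F[symmetric] beads_def
    by (rule range_eqI[of _ _ 0]) simp
  then have x: "int (lam 0) - 1 + ?c < x" using insert by auto
  \<comment> \<open>The first row is forced by its bead being \<open>x\<close> at charge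
    \<open>?c + 1\<close>. As \<open>x\<close> exceeds the former first bead, \<open>x - ?c\<close>
    is at least \<open>lam 0\<close>, so \<open>nat\<close> is exact and the rows stay
    decreasing.\<close>
  define mu where "mu = case_nat (nat (x - ?c)) lam"
  have mu0: "int (mu 0) = x - ?c" unfolding mu_def using x by simp
  have muS: "mu (Suc i) = lam i" for i unfolding mu_def by simp
  have "mu (Suc i) \<le> mu i" for i
    using lam x mu0 by (cases i) (auto simp: muS is_partition_def antimono_def)
  then have "antimono mu" unfolding antimono_def
    by (metis lift_Suc_antimono_le)
  moreover have "i \<in> insert 0 (Suc ` {i. lam i \<noteq> 0})" if "mu i \<noteq> 0" for i
    using that by (cases i) (auto simp: muS)
  then have "{i. mu i \<noteq> 0} \<subseteq> insert 0 (Suc ` {i. lam i \<noteq> 0})" by blast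
  then have "finite {i. mu i \<noteq> 0}"
    using lam finite_subset unfolding is_partition_def by blast
  ultimately have "is_partition mu" unfolding is_partition_def by blast
  moreover have UNIV: "(UNIV :: nat set) = insert 0 (range Suc)"
    unfolding greaterThan_0[symmetric] by auto
  have range: "range f = insert (f 0) (range (\<lambda>i. f (Suc i)))" for f :: "nat \<Rightarrow> int"
    by (subst UNIV) (simp add: image_image)
  have "beads (?c + 1) mu
      = insert (int (mu 0) - 1 + (?c + 1)) (range (\<lambda>i. int (lam i) - int i - 1 + ?c))"
    unfolding beads_def by (subst range) (simp add: muS algebra_simps)
  then have "beads (?c + 1) mu = insert x (F \<union> {..<m})"
    unfolding F[symmetric] mu0 unfolding beads_def by simp
  moreover have "x \<notin> F" using insert.hyps(2) by force
  then have "m + int (card (insert x F)) = ?c + 1" using insert.hyps(1) by simp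
  ultimately show ?case by (intro exI[of _ mu]) (simp only: Un_insert_left)
qed

lemma ex_partition_beads:
  assumes X: "bead_set X"
  shows "\<exists>lam. is_partition lam \<and> beads (charge X) lam = X"
proof -
  obtain m where m: "{..<m} \<subseteq> X" using X unfolding bead_set_def by blast
  have "finite (X - {..<m})" using X finite_bead_set_diff bead_set_lessThan by blast
  from ex_partition_beads_Un[OF this, of m]
  obtain lam c where lam: "is_partition lam" "beads c lam = X - {..<m} \<union> {..<m}" by fastforce
  then have "beads c lam = X" using m by auto
  then show ?thesis using lam charge_beads by metis
qed

subsection \<open>Residue contents in terms of beads\<close>

text \<open>The quotient by \<open>s\<close> grows by one exactly on reaching a multiple of
  \<open>s\<close>, so a difference of quotients counts the multiples of \<open>s\<close> from
  \<open>x + 1\<close> to \<open>x + L\<close>.\<close>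

lemma card_row_residue:
  assumes "s > 0"
  shows "int (card {b\<in>{1..L}. int s dvd int b + x}) = (int L + x) div int s - x div int s"
proof (induction L)
  case (Suc L)
  have "{b\<in>{1..Suc L}. int s dvd int b + x}
      = {b\<in>{1..L}. int s dvd int b + x} \<union> {b. b = Suc L \<and> int s dvd int (Suc L) + x}"
    by (auto simp: le_Suc_eq)
  also have "int (card \<dots>) = int (card {b\<in>{1..L}. int s dvd int b + x})
      + of_bool (int s dvd int (Suc L) + x)"
    by (subst card_Un_disjoint) auto
  also have "\<dots> = (int (Suc L) + x) div int s - x div int s"
  proof -
    have "(y + 1) div int s = y div int s + of_bool (int s dvd y + 1)" for y :: int
    proof -
      define q r where "q = y div int s" and "r = y mod int s"
      have y: "y = int s * q + r" unfolding q_def r_def by (rule mult_div_mod_eq[symmetric])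
      have r: "0 \<le> r" "r < int s" using assms unfolding r_def by auto
      show ?thesis
      proof (cases "r + 1 = int s")
        case True
        then have y1: "y + 1 = int s * (q + 1)" unfolding y by (simp add: algebra_simps)
        show ?thesis unfolding q_def[symmetric] y1 using assms by simp
      next
        case False
        then have "(y + 1) div int s = q" "(y + 1) mod int s = r + 1"
          using r by (auto simp: y intro!: int_div_pos_eq[where r = "r + 1"] int_mod_pos_eq[where q = q])
        moreover have "r + 1 \<noteq> 0" using r by simp
        ultimately show ?thesis unfolding q_def[symmetric] dvd_eq_mod_eq_0 by simp
      qed
    qed
    from this[of "int L + x"] show ?thesis
      unfolding Suc.IH by (simp add: add.assoc add.commute add.left_commute)
  qed
  finally show ?case .
qed simp

definition residue_class :: "nat \<Rightarrow> int \<Rightarrow> int set" where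
  "residue_class s r = {r + int s * m | m. True}"

lemma residue_class_eq_iff: "residue_class s x = residue_class s r \<longleftrightarrow> int s dvd x - r"
proof
  assume "residue_class s x = residue_class s r"
  moreover have "x \<in> residue_class s x" unfolding residue_class_def by (auto intro: exI[of _ 0])
  ultimately show "int s dvd x - r" unfolding residue_class_def by auto
next
  assume "int s dvd x - r"
  then obtain k where k: "x = r + int s * k" by (metis dvdE diff_add_cancel add.commute)
  show "residue_class s x = residue_class s r"
  proof (intro equalityI subsetI)
    fix z assume "z \<in> residue_class s x"
    then obtain m where "z = x + int s * m" unfolding residue_class_def by blast
    then have "z = r + int s * (k + m)" using k by (simp add: algebra_simps)
    then show "z \<in> residue_class s r" unfolding residue_class_def by blast
  next
    fix z assume "z \<in> residue_class s r"
    then obtain m where "z = r + int s * m" unfolding residue_class_def by blast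
    then have "z = x + int s * (m - k)" using k by (simp add: algebra_simps)
    then show "z \<in> residue_class s x" unfolding residue_class_def by blast
  qed
qed

lemma residue_eq_residue_class:
  "residue s c (i, b, k) = residue_class s (int b - int i + (if k = 1 then fst c else snd c))"
  unfolding residue_def residue_class_def by simp

text \<open>In row \<open>i\<close> the values \<open>b - Suc i + c\<close> run from
  \<open>c - i\<close> up to the bead of the row. The count is thus a difference of quotients at
  this bead and at \<open>c - i - 1\<close>, the bead of an empty row; summing over the rows gives
  \<open>dev\<close>.\<close>

lemma card_component_residue:
  assumes "s > 0" and lam: "is_partition lam"
  shows "int (card {(Suc i, b, k) | i b. 1 \<le> b \<and> b \<le> lam i \<and> int s dvd int b - int (Suc i) + c - r})
    = dev (\<lambda>x. (x - r) div int s) (beads c lam) - dev (\<lambda>x. (x - r) div int s) {..<c}"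
proof -
  obtain n where n: "\<And>i. i \<ge> n \<Longrightarrow> lam i = 0" using partition_eventually_0[OF lam] by blast
  let ?B = "\<lambda>i. {b\<in>{1..lam i}. int s dvd int b + (c - int i - 1 - r)}"
  have "{(Suc i, b, k) | i b. 1 \<le> b \<and> b \<le> lam i \<and> int s dvd int b - int (Suc i) + c - r}
      = (\<lambda>(i, b). (Suc i, b, k)) ` (SIGMA i : {..<n}. ?B i)" (is "?N = ?R")
  proof (intro equalityI subsetI)
    fix z assume "z \<in> ?N"
    then obtain i b where z: "z = (Suc i, b, k)" "1 \<le> b" "b \<le> lam i"
      "int s dvd int b - int (Suc i) + c - r" by blast
    then have "i < n" using n[of i] by (cases "i < n") auto
    then show "z \<in> ?R" using z by (auto simp: algebra_simps)
  qed (auto simp: algebra_simps)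
  moreover have "inj_on (\<lambda>(i, b). (Suc i, b, k)) (SIGMA i : {..<n}. ?B i)"
    by (auto intro!: inj_onI)
  ultimately have "int (card ?N) = int (\<Sum>i<n. card (?B i))"
    by (simp add: card_image)
  also have "\<dots> = (\<Sum>i<n. (int (lam i) - int i - 1 + c - r) div int s - (c - int i - 1 - r) div int s)"
    unfolding of_nat_sum card_row_residue[OF assms(1)]
    by (intro sum.cong refl arg_cong2[of _ _ _ _ "(-)"] arg_cong2[of _ _ _ _ "(div)"]) simp_all
  finally show ?thesis using dev_beads[OF lam n, where g = "\<lambda>x. (x - r) div int s"] by simp
qed

lemma count_content:
  assumes "s > 0" and bp: "is_bipartition bp"
  shows "int (count (content s (c1, c2) bp) (residue_class s r))
    = dev (\<lambda>x. (x - r) div int s) (beads c1 (fst bp)) - dev (\<lambda>x. (x - r) div int s) {..<c1}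
    + (dev (\<lambda>x. (x - r) div int s) (beads c2 (snd bp)) - dev (\<lambda>x. (x - r) div int s) {..<c2})"
proof -
  let ?N = "\<lambda>lam k c. {(Suc i, b, k :: nat) | i b.
    1 \<le> b \<and> b \<le> lam i \<and> int s dvd int b - int (Suc i) + c - r}"
  have fin: "finite (nodes bp)" using bp by (rule finite_nodes)
  have eq: "{v \<in> nodes bp. residue s (c1, c2) v = residue_class s r}
      = ?N (fst bp) 1 c1 \<union> ?N (snd bp) 2 c2"
    unfolding nodes_def
    by (intro equalityI subsetI)
      (auto simp: residue_eq_residue_class residue_class_eq_iff del: equalityI)
  have "count (content s (c1, c2) bp) (residue_class s r)
      = card {v \<in> nodes bp. residue s (c1, c2) v = residue_class s r}"
    unfolding content_def using fin
    by (simp add: count_image_mset vimage_def Int_def conj_commute)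
  also have "\<dots> = card (?N (fst bp) 1 c1) + card (?N (snd bp) 2 c2)"
  proof -
    have "finite (?N (fst bp) 1 c1 \<union> ?N (snd bp) 2 c2)"
      unfolding eq[symmetric] using fin by simp
    then show ?thesis unfolding eq by (intro card_Un_disjoint) auto
  qed
  finally show ?thesis
    using bp unfolding is_bipartition_def by (simp only: of_nat_add card_component_residue[OF assms(1)])
qed

text \<open>The terms for \<open>{..<c1}\<close> and \<open>{..<c2}\<close> in
  \<open>count_content\<close> are the same on both sides, and anything that is not a residue class
  has multiplicity 0.\<close>

lemma content_eq_iff:
  assumes "s > 0" "is_bipartition bp" "is_bipartition bp'"
  shows "content s (c1, c2) bp = content s (c1, c2) bp' \<longleftrightarrow>
    (\<forall>r. dev (\<lambda>x. (x - r) div int s) (beads c1 (fst bp))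
        + dev (\<lambda>x. (x - r) div int s) (beads c2 (snd bp))
      = dev (\<lambda>x. (x - r) div int s) (beads c1 (fst bp'))
        + dev (\<lambda>x. (x - r) div int s) (beads c2 (snd bp')))"
    (is "?L \<longleftrightarrow> (\<forall>r. ?D bp r = ?D bp' r)")
proof -
  have *: "?D bp r = ?D bp' r \<longleftrightarrow> count (content s (c1, c2) bp) (residue_class s r)
      = count (content s (c1, c2) bp') (residue_class s r)" for r
    using count_content[OF assms(1,2), of c1 c2 r] count_content[OF assms(1,3), of c1 c2 r]
    by linarith
  have out: "count (content s (c1, c2) v) R = 0" if "R \<notin> range (residue_class s)" for v R
  proof -
    have "residue s (c1, c2) w \<in> range (residue_class s)" for w
      by (cases w) (simp add: residue_eq_residue_class)
    then have "R \<notin># content s (c1, c2) v" using that unfolding content_def by auto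
    then show ?thesis by (simp add: not_in_iff)
  qed
  show ?thesis
  proof
    assume "\<forall>r. ?D bp r = ?D bp' r"
    then have "count (content s (c1, c2) bp) R = count (content s (c1, c2) bp') R" for R
      using * out[of R] by (cases "R \<in> range (residue_class s)") (blast, simp)
    then show ?L by (rule multiset_eqI)
  qed (use * in auto)
qed

subsection \<open>Cores as linked pairs of bead sets\<close>

text \<open>Call a residue class modulo \<open>s\<close> a runner. For \<open>s > 0\<close> and a
  bead set \<open>Y\<close>, each runner of \<open>Y\<close> is filled up to a topmost bead, and
  \<open>X\<close> can lack only such topmost beads.\<close>

definition linked :: "nat \<Rightarrow> int set \<Rightarrow> int set \<Rightarrow> bool" where
  "linked s X Y \<longleftrightarrow> X \<subseteq> Y \<and> (\<forall>y\<in>Y. y - int s \<in> X)"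

text \<open>The elements of \<open>Y\<close> on the runner of \<open>x\<close> from
  \<open>l - s\<close> on form a finite set \<open>S\<close>. It contains \<open>y0\<close>, the
  greatest integer below \<open>l\<close> on that runner, so a maximum exists.\<close>

lemma ex_top_bead:
  assumes Y: "bead_set Y" and s: "s > 0"
  shows "\<exists>y\<in>Y. y + int s \<notin> Y \<and> int s dvd y - x"
proof -
  obtain l u where l: "{..<l} \<subseteq> Y" and u: "Y \<subseteq> {..<u}" using Y unfolding bead_set_def by blast
  define S where "S = {y\<in>Y. int s dvd y - x \<and> l - int s \<le> y}"
  have "S \<subseteq> {l - int s..<u}" unfolding S_def using u by auto
  then have fin: "finite S" using finite_subset by blast
  define y0 where "y0 = l - 1 - (l - 1 - x) mod int s"
  have "y0 < l" "l - int s \<le> y0"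
    using s pos_mod_bound[of "int s" "l - 1 - x"] pos_mod_sign[of "int s" "l - 1 - x"]
    unfolding y0_def by linarith+
  moreover have "int s dvd y0 - x"
    using dvd_minus_mod[of "int s" "l - 1 - x"] unfolding y0_def by (simp add: algebra_simps)
  ultimately have "y0 \<in> S" using l unfolding S_def by auto
  then have M: "Max S \<in> S" "\<And>y. y \<in> S \<Longrightarrow> y \<le> Max S" using fin by (auto intro: Max_in)
  have "Max S + int s \<notin> Y"
  proof
    assume "Max S + int s \<in> Y"
    moreover have "int s dvd (Max S - x) + int s" using M(1) unfolding S_def by simp
    then have "int s dvd Max S + int s - x" by (simp add: algebra_simps)
    ultimately have "Max S + int s \<in> S" using M(1) unfolding S_def by auto
    then show False using M(2)[of "Max S + int s"] s by simp
  qed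
  then show ?thesis using M(1) unfolding S_def by blast
qed

lemma linked_minus_mult:
  assumes "linked s X Y" "y \<in> Y"
  shows "m > 0 \<Longrightarrow> y - int s * int m \<in> X" and "y - int s * int m \<in> Y"
proof -
  show *: "y - int s * int m \<in> Y" for m
  proof (induction m)
    case (Suc m)
    then have "y - int s * int m - int s \<in> X" using assms unfolding linked_def by blast
    then show ?case using assms unfolding linked_def by (auto simp: algebra_simps)
  qed (use assms in simp)
  assume "m > 0"
  then obtain k where "m = Suc k" using gr0_implies_Suc by blast
  moreover have "y - int s * int k - int s \<in> X" using *[of k] assms unfolding linked_def by blast
  ultimately show "y - int s * int m \<in> X" by (simp add: algebra_simps)
qed

lemma linked_below:
  assumes lnk: "linked s X Y" and s: "s > 0" and y: "y \<in> Y" and dvd: "int s dvd y - x"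
  shows "x < y \<Longrightarrow> x \<in> X" and "x \<le> y \<Longrightarrow> x \<in> Y"
proof -
  obtain k where k: "y - x = int s * k" using dvd by blast
  have "x = y - int s * int (nat k)" if "x \<le> y"
    using that k s zero_le_mult_iff[of "int s" k] by simp
  moreover have "nat k > 0" if "x < y" using that k s zero_less_mult_iff[of "int s" k] by simp
  ultimately show "x < y \<Longrightarrow> x \<in> X" and "x \<le> y \<Longrightarrow> x \<in> Y"
    using linked_minus_mult[OF lnk y] by (metis less_imp_le)+
qed

text \<open>Runners of a linked pair have no gaps, so a bead above \<open>y\<close> would force
  \<open>y + s\<close> into \<open>Y\<close>.\<close>

lemma linked_le_top:
  assumes lnk: "linked s X Y" and s: "s > 0" and y: "y + int s \<notin> Y" and x: "x \<in> Y"
    and dvd: "int s dvd y - x"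
  shows "x \<le> y"
proof (rule ccontr)
  assume "\<not> x \<le> y"
  moreover have dvd': "int s dvd x - y" using dvd by (simp add: dvd_diff_commute)
  ultimately have "int s \<le> x - y" using zdvd_imp_le by simp
  moreover have "int s dvd x - (y + int s)"
    unfolding diff_diff_eq[symmetric] by (rule dvd_diff[OF dvd' dvd_refl])
  ultimately show False using linked_below(2)[OF lnk s x, of "y + int s"] y by simp
qed

text \<open>The case \<open>L = 1\<close> of the row count. Differencing in \<open>r\<close> thus
  isolates a single runner.\<close>

lemma div_shift_residue:
  fixes d :: int
  assumes "d > 0"
  shows "(x - r) div d - (x - r - 1) div d = of_bool (d dvd x - r)"
proof -
  have "(x - r) div d - (x - r - 1) div d = int (card {b\<in>{1..1::nat}. d dvd int b + (x - r - 1)})"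
    using card_row_residue[of "nat d" 1 "x - r - 1"] assms by simp
  also have "{b\<in>{1..1::nat}. d dvd int b + (x - r - 1)} = (if d dvd x - r then {1} else {})"
    by auto
  finally show ?thesis by simp
qed

text \<open>
  With \<open>f = 1\<^sub>X + 1\<^sub>Y\<close>, a linked pair has \<open>f = 2\<close> below and \<open>f = 0\<close> above the topmost bead of
  \<open>Y\<close> on each runner, so it strictly minimises a weight that increases along the runners.
\<close>
lemma linked_unique:
  assumes s: "s > 0" and lnk: "linked s X Y"
    and bs: "bead_set X" "bead_set Y" "bead_set X'" "bead_set Y'"
    and charge: "charge X' = charge X" "charge Y' = charge Y"
    and dev: "\<And>r. dev (\<lambda>x. (x - r) div int s) X' + dev (\<lambda>x. (x - r) div int s) Y'
      = dev (\<lambda>x. (x - r) div int s) X + dev (\<lambda>x. (x - r) div int s) Y"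
  shows "X' = X \<and> Y' = Y"
proof -
  define Z where "Z = (X - X') \<union> (X' - X) \<union> (Y - Y') \<union> (Y' - Y)"
  define \<delta> :: "int \<Rightarrow> int" where "\<delta> x = (of_bool (x \<in> X') - of_bool (x \<in> X))
    + (of_bool (x \<in> Y') - of_bool (x \<in> Y))" for x
  have finZ: "finite Z" unfolding Z_def using bs finite_bead_set_diff by blast
  have sum: "dev g X' - dev g X + (dev g Y' - dev g Y) = (\<Sum>x\<in>Z. g x * \<delta> x)" for g
    unfolding \<delta>_def distrib_left sum.distrib using finZ bs
    by (intro arg_cong2[of _ _ _ _ "(+)"] dev_diff_of_bool) (auto simp: Z_def)
  have 1: "(\<Sum>x\<in>Z. (x - r) div int s * \<delta> x) = 0" for r
    using dev[of r] unfolding sum[symmetric] by linarith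
  \<comment> \<open>Subtracting fact 1 at \<open>r + 1\<close> from fact 1 at \<open>r\<close>
    leaves the indicator of one runner, so \<open>\<delta>\<close> sums to 0 over every
    runner.\<close>
  have 2: "(\<Sum>x\<in>Z. of_bool (int s dvd x - r) * \<delta> x) = 0" for r
  proof -
    have "(\<Sum>x\<in>Z. of_bool (int s dvd x - r) * \<delta> x)
        = (\<Sum>x\<in>Z. (x - r) div int s * \<delta> x - (x - (r + 1)) div int s * \<delta> x)"
      unfolding left_diff_distrib[symmetric] diff_diff_eq[symmetric] using s
      by (simp add: div_shift_residue)
    then show ?thesis using 1 by (simp add: sum_subtractf)
  qed
  obtain top where top: "\<And>x. top x \<in> Y" "\<And>x. top x + int s \<notin> Y" "\<And>x. int s dvd top x - x"
    using ex_top_bead[OF bs(2) s] by metis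
  define T where "T x = top (x mod int s)" for x
  have T: "T x \<in> Y" "T x + int s \<notin> Y" "int s dvd T x - x" for x
  proof -
    show "int s dvd T x - x"
      using dvd_diff[OF top(3)[of "x mod int s"] dvd_minus_mod[of "int s" x]]
      unfolding T_def by (simp only: diff_diff_eq2 diff_add_cancel)
  qed (auto simp: T_def top)
  have above: "x \<notin> Y" if "T x < x" for x
    using linked_le_top[OF lnk s T(2)[of x] _ T(3)[of x]] that by force
  have below: "x \<in> X" "x \<in> Y" if "x < T x" for x
    using linked_below[OF lnk s T(1)[of x] T(3)[of x]] that by simp_all
  \<comment> \<open>The height of \<open>x\<close> relative to the topmost bead of its runner, in
    steps of \<open>s\<close>.\<close>
  define h where "h x = x div int s - T x div int s" for x
  have h: "h x = (x - T x) div int s" for x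
  proof -
    have "int s dvd x - T x" using T(3)[of x] by (simp add: dvd_diff_commute)
    then obtain k where k: "x - T x = int s * k" by blast
    then have x: "x = T x + int s * k" by simp
    have "x div int s = T x div int s + k" using s by (subst x) simp
    then show ?thesis unfolding h_def k using s by simp
  qed
  \<comment> \<open>\<open>T\<close> is constant on runners, so fact 2 removes this sum; the weight
    \<open>h\<close> may then replace the quotient by \<open>s\<close>.\<close>
  have "(\<Sum>x\<in>Z. T x div int s * \<delta> x) = 0"
  proof -
    have "T x div int s = (\<Sum>r\<in>{0..<int s}. top r div int s * of_bool (int s dvd x - r))" for x
    proof -
      have "(\<Sum>r\<in>{0..<int s}. top r div int s * of_bool (int s dvd x - r))
          = (\<Sum>r\<in>{0..<int s}. if r = x mod int s then top r div int s else 0)"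
        using s by (intro sum.cong) (auto simp: mod_eq_dvd_iff[symmetric])
      then show ?thesis using s by (simp add: T_def)
    qed
    then have "(\<Sum>x\<in>Z. T x div int s * \<delta> x)
        = (\<Sum>x\<in>Z. \<Sum>r\<in>{0..<int s}. top r div int s * (of_bool (int s dvd x - r) * \<delta> x))"
      by (simp only: sum_distrib_right mult.assoc)
    also have "\<dots> = (\<Sum>r\<in>{0..<int s}. top r div int s * (\<Sum>x\<in>Z. of_bool (int s dvd x - r) * \<delta> x))"
      unfolding sum_distrib_left by (rule sum.swap)
    finally show ?thesis by (simp add: 2)
  qed
  then have "(\<Sum>x\<in>Z. h x * \<delta> x) = 0"
    unfolding h_def using 1[of 0] by (simp add: left_diff_distrib sum_subtractf)
  \<comment> \<open>Below the top both \<open>X\<close> and \<open>Y\<close> are occupied and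
    \<open>\<delta>\<close> cannot be positive; above it both are empty and \<open>\<delta>\<close>
    cannot be negative. This matches the sign of \<open>h\<close>.\<close>
  moreover have nonneg: "0 \<le> h x * \<delta> x" for x
  proof -
    consider "x < T x" | "x = T x" | "T x < x" by linarith
    then show ?thesis
    proof cases
      case 1
      then have "h x \<le> 0" "\<delta> x \<le> 0" using s below[of x]
        by (auto simp: h \<delta>_def div_nonpos_pos_le0)
      then show ?thesis by (simp add: mult_nonpos_nonpos)
    next
      case 3
      then have "x \<notin> X" "x \<notin> Y" using above lnk unfolding linked_def by auto
      then have "h x \<ge> 0" "\<delta> x \<ge> 0" using 3 s
        by (auto simp: h \<delta>_def pos_imp_zdiv_nonneg_iff)
      then show ?thesis by simp
    qed (simp add: h)
  qed
  ultimately have "\<forall>x\<in>Z. h x * \<delta> x = 0"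
    using sum_nonneg_eq_0_iff[OF finZ, of "\<lambda>x. h x * \<delta> x"] by simp
  then have h0: "h x * \<delta> x = 0" if "x \<in> Z" for x using that by blast
  have hT: "x = T x" if "h x = 0" for x
  proof -
    have "int s dvd x - T x" using T(3)[of x] by (simp add: dvd_diff_commute)
    then have "x - T x = int s * h x" unfolding h by simp
    then show ?thesis using that by simp
  qed
  \<comment> \<open>Now \<open>\<delta>\<close> can be non-zero only at the tops, one per runner,
    where the runner sums of fact 2 force it to vanish.\<close>
  have \<delta>0: "\<delta> x = 0" for x
  proof (cases "x \<in> Z \<and> x = T x")
    case True
    have "of_bool (int s dvd y - x) * \<delta> y = 0" if "y \<in> Z - {x}" for y
    proof (cases "int s dvd y - x")
      case dvd: True
      then have "T y = T x" unfolding T_def by (simp add: mod_eq_dvd_iff[symmetric])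
      then have "y \<noteq> T y" using True that by auto
      then show ?thesis using h0[of y] hT[of y] that by auto
    qed simp
    then have "(\<Sum>y\<in>Z - {x}. of_bool (int s dvd y - x) * \<delta> y) = 0" by (intro sum.neutral) blast
    then show ?thesis using 2[of x] True sum.remove[OF finZ, of x "\<lambda>y. of_bool (int s dvd y - x) * \<delta> y"]
      by simp
  next
    case False
    then show ?thesis
    proof (cases "x \<in> Z")
      case True
      then show ?thesis using False h0[of x] hT[of x] by auto
    qed (auto simp: Z_def \<delta>_def)
  qed
  \<comment> \<open>Equal occupation numbers and \<open>X \<subseteq> Y\<close> make
    \<open>X\<close> the intersection and \<open>Y\<close> the union of \<open>X'\<close> and
    \<open>Y'\<close>. The charges then rule out elements of \<open>X' - Y'\<close>.\<close>
  have bits: "(x \<in> X' \<and> x \<in> Y') = (x \<in> X)" "(x \<in> X' \<or> x \<in> Y') = (x \<in> Y)" for x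
    using \<delta>0[of x] lnk unfolding \<delta>_def linked_def by (auto simp: of_bool_def split: if_splits)
  have fin: "finite (X' - Y')" "finite (Y' - X')" using bs finite_bead_set_diff by blast+
  have "int (card (Y' - X')) - int (card (X' - Y')) = int (card (Y - X)) - int (card (X - Y))"
    using charge dev_diff[OF bs(1,2), of "\<lambda>_. 1"] dev_diff[OF bs(3,4), of "\<lambda>_. 1"] by simp
  moreover have "X - Y = {}" using lnk unfolding linked_def by blast
  moreover have "Y - X = (Y' - X') \<union> (X' - Y')" using bits by blast
  then have "card (Y - X) = card (Y' - X') + card (X' - Y')"
    using fin by (simp only:) (rule card_Un_disjoint; blast)
  ultimately have "card (X' - Y') = 0" by (simp del: Diff_eq_empty_iff)
  then have "X' - Y' = {}" using fin by simp
  then show ?thesis using bits by blast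
qed

section \<open>Content-preserving bead moves\<close>

lemma bead_set_move: "bead_set X \<Longrightarrow> bead_set (insert y (X - {x}))"
  by (intro bead_set_insert bead_set_remove)

lemma dev_move:
  assumes "bead_set X" "x \<in> X" "y \<notin> X"
  shows "dev g (insert y (X - {x})) = dev g X - g x + g y"
  using assms by (simp add: dev_insert dev_remove bead_set_remove)

text \<open>Each failure of linkedness yields another admissible pair: either two beads are
  exchanged between \<open>X\<close> and \<open>Y\<close>, or one bead moves up by \<open>s\<close>
  while another moves down by \<open>s\<close>.\<close>

lemma linked_if_unique:
  assumes as: "a < s" and bs: "bead_set X" "bead_set Y" and charge: "charge Y = charge X + int a"
    and unique: "\<And>X' Y'. \<lbrakk>bead_set X'; bead_set Y'; charge X' = charge X; charge Y' = charge Y;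
      \<And>r. dev (\<lambda>x. (x - r) div int s) X' + dev (\<lambda>x. (x - r) div int s) Y'
        = dev (\<lambda>x. (x - r) div int s) X + dev (\<lambda>x. (x - r) div int s) Y\<rbrakk> \<Longrightarrow> X' = X \<and> Y' = Y"
  shows "linked s X Y"
proof -
  have s: "s > 0" using as by simp
  have fin: "finite (X - Y)" "finite (Y - X)" using bs finite_bead_set_diff by blast+
  have card: "int (card (Y - X)) - int (card (X - Y)) = int a"
    using dev_diff[OF bs, of "\<lambda>_. 1"] charge by simp
  note moves = bead_set_move dev_move bead_set_insert bead_set_remove dev_insert dev_remove
  have sub: "X \<subseteq> Y"
  proof (rule ccontr)
    assume "\<not> X \<subseteq> Y"
    then obtain x where x: "x \<in> X" "x \<notin> Y" by blast
    then have "card (X - Y) > 0" using fin by (auto simp: card_gt_0_iff)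
    then have "card (Y - X) > 0" using card by linarith
    then obtain y where y: "y \<in> Y" "y \<notin> X" by (metis Diff_iff all_not_in_conv card.empty less_irrefl)
    have "insert y (X - {x}) = X \<and> insert x (Y - {y}) = Y"
      using x y bs by (intro unique) (simp_all add: moves)
    then show False using y by blast
  qed
  \<comment> \<open>Each of the \<open>s\<close> runners has a bead of \<open>Y\<close> with no bead
    of \<open>Y\<close> at distance \<open>s\<close> above it. Only
    \<open>card (Y - X) = a < s\<close> of them can be missing from \<open>X\<close>.\<close>
  obtain z where z: "z \<in> X" "z + int s \<notin> Y"
  proof -
    obtain top where top: "\<And>x. top x \<in> Y" "\<And>x. top x + int s \<notin> Y" "\<And>x. int s dvd top x - x"
      using ex_top_bead[OF bs(2) s] by metis
    have mod: "top x mod int s = x mod int s" for x using top(3)[of x] by (simp add: mod_eq_dvd_iff)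
    have "inj_on top {0..<int s}"
      using mod by (intro inj_onI) (metis atLeastLessThan_iff mod_pos_pos_trivial)
    then have "card (top ` {0..<int s}) = s" by (simp add: card_image)
    moreover have "card (Y - X) < s"
    proof -
      have "card (X - Y) = 0" using sub by (metis Diff_eq_empty_iff card.empty)
      then show ?thesis using card as by linarith
    qed
    ultimately have "\<not> top ` {0..<int s} \<subseteq> Y - X" using card_mono[OF fin(2)] by (metis not_le)
    then show ?thesis using top that by blast
  qed
  have zX: "z + int s \<notin> X" using z sub by blast
  have shift: "(x + int s - r) div int s = (x - r) div int s + 1"
    "(x - int s - r) div int s = (x - r) div int s - 1" for x r
    using div_add_self2[of "int s" "x - r"] div_add_self2[of "int s" "x - int s - r"] s
    by (simp_all add: algebra_simps)
  have "y - int s \<in> X" if y: "y \<in> Y" for y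
  proof (rule ccontr)
    assume ys: "y - int s \<notin> X"
    \<comment> \<open>In each case \<open>z\<close> goes up and \<open>y\<close> goes down by
      \<open>s\<close>. Only the total over both sets matters, so the receiving sets are chosen to
      have the target places free.\<close>
    consider "y - int s \<notin> Y" | "y - int s \<in> Y" "y \<in> X" | "y - int s \<in> Y" "y \<notin> X" by blast
    then show False
    proof cases
      case 1
      have "insert (z + int s) (X - {z}) = X \<and> insert (y - int s) (Y - {y}) = Y"
        using 1 y z zX sub bs by (intro unique) (auto simp: moves shift)
      then show False using 1 by blast
    next
      case 2
      have "insert (y - int s) (X - {y}) = X \<and> insert (z + int s) (Y - {z}) = Y"
        using 2 y z zX ys sub bs by (intro unique) (auto simp: moves shift)
      then show False using ys by blast
    next
      case 3
      have "insert (y - int s) (X - {z}) = X \<and> insert (z + int s) (Y - {y}) = Y"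
        using 3 y z zX ys sub bs by (intro unique) (auto simp: moves shift)
      then show False using ys by blast
    qed
  qed
  then show ?thesis using sub unfolding linked_def by blast
qed

text \<open>For \<open>s \<noteq> 1\<close> the two preceding uniqueness results give the two
  directions. For \<open>s = 1\<close>, where cores are defined separately, \<open>a = 0\<close>;
  the single runner makes \<open>Y\<close> an interval of charge 0, and equal charges give
  \<open>X = Y\<close>.\<close>

lemma is_core_iff_linked:
  assumes "a < s" and bp: "is_bipartition bp"
  shows "is_core s (0, int a) bp \<longleftrightarrow> linked s (beads 0 (fst bp)) (beads (int a) (snd bp))"
proof (cases "s = 1")
  case True
  then have a: "a = 0" using assms by simp
  have part: "is_partition (fst bp)" "is_partition (snd bp)" "is_partition empty_partition"
    using bp unfolding is_bipartition_def by (auto simp: is_partition_def empty_partition_def antimono_def)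
  have bs: "bead_set (beads 0 (fst bp))" "bead_set (beads 0 (snd bp))"
    using part by (simp_all add: bead_set_beads)
  have empty: "beads 0 empty_partition = {..<0}"
    unfolding empty_partition_def by (rule beads_zero)
  show ?thesis
  proof
    assume "is_core s (0, int a) bp"
    then have "fst bp = empty_partition" "snd bp = empty_partition"
      using True unfolding is_core_def by auto
    then show "linked s (beads 0 (fst bp)) (beads (int a) (snd bp))"
      using a True by (simp add: empty linked_def)
  next
    assume lnk: "linked s (beads 0 (fst bp)) (beads (int a) (snd bp))"
    then have lnk: "linked 1 (beads 0 (fst bp)) (beads 0 (snd bp))" using True a by simp
    obtain y where y: "y \<in> beads 0 (snd bp)" "y + 1 \<notin> beads 0 (snd bp)"
      using ex_top_bead[OF bs(2), of 1] by auto
    have "x \<in> beads 0 (snd bp) \<longleftrightarrow> x < y + 1" for x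
      using linked_below(2)[OF lnk _ y(1), of x] linked_below(2)[OF lnk, of x "y + 1"] y(2)
      by force
    then have Y: "beads 0 (snd bp) = {..<y + 1}" by blast
    then have "y + 1 = 0" using charge_beads[OF part(2), of 0] charge_lessThan by metis
    then have Y0: "beads 0 (snd bp) = {..<0}" using Y by simp
    moreover have "beads 0 (fst bp) = {..<0}"
    proof -
      let ?X = "beads 0 (fst bp)" and ?Y = "beads 0 (snd bp)"
      have "?X - ?Y = {}" using lnk unfolding linked_def by blast
      then have "card (?X - ?Y) = 0" by (metis card.empty)
      then have "card (?Y - ?X) = 0"
        using dev_diff[OF bs, of "\<lambda>_. 1"] by (simp add: charge_beads part)
      then have "?Y - ?X = {}" using finite_bead_set_diff[OF bs(2,1)] by simp
      then show ?thesis using \<open>?X - ?Y = {}\<close> Y0 by blast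
    qed
    ultimately have "fst bp = empty_partition" "snd bp = empty_partition"
      using part empty by (auto intro: beads_inject)
    then show "is_core s (0, int a) bp" using True bp unfolding is_core_def by (metis prod.collapse)
  qed
next
  case False
  have s: "s > 0" using assms by simp
  have part: "is_partition (fst bp)" "is_partition (snd bp)" using bp unfolding is_bipartition_def by auto
  note bs = part[THEN bead_set_beads]
  show ?thesis
  proof
    assume core: "is_core s (0, int a) bp"
    show "linked s (beads 0 (fst bp)) (beads (int a) (snd bp))"
    proof (rule linked_if_unique[OF assms(1) bs])
      fix X' Y'
      assume bs': "bead_set X'" "bead_set Y'"
        and charge: "charge X' = charge (beads 0 (fst bp))" "charge Y' = charge (beads (int a) (snd bp))"
        and dev: "\<And>r. dev (\<lambda>x. (x - r) div int s) X' + dev (\<lambda>x. (x - r) div int s) Y'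
          = dev (\<lambda>x. (x - r) div int s) (beads 0 (fst bp))
            + dev (\<lambda>x. (x - r) div int s) (beads (int a) (snd bp))"
      obtain lam mu where lam: "is_partition lam" "beads 0 lam = X'"
        and mu: "is_partition mu" "beads (int a) mu = Y'"
        using ex_partition_beads[OF bs'(1)] ex_partition_beads[OF bs'(2)] charge
          charge_beads[OF part(1)] charge_beads[OF part(2)] by metis
      then have bp': "is_bipartition (lam, mu)" unfolding is_bipartition_def by simp
      have "content s (0, int a) (lam, mu) = content s (0, int a) bp"
        unfolding content_eq_iff[OF s bp' bp] using dev lam mu by simp
      then have "(lam, mu) = bp" using core bp' False unfolding is_core_def by auto
      then show "X' = beads 0 (fst bp) \<and> Y' = beads (int a) (snd bp)" using lam mu by auto
    qed (simp add: charge_beads part)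
  next
    assume lnk: "linked s (beads 0 (fst bp)) (beads (int a) (snd bp))"
    have "bp' = bp" if bp': "is_bipartition bp'"
      and content: "content s (0, int a) bp' = content s (0, int a) bp" for bp'
    proof -
      have part': "is_partition (fst bp')" "is_partition (snd bp')"
        using bp' unfolding is_bipartition_def by auto
      have "beads 0 (fst bp') = beads 0 (fst bp) \<and> beads (int a) (snd bp') = beads (int a) (snd bp)"
        using content unfolding content_eq_iff[OF s bp' bp]
        by (intro linked_unique[OF s lnk bs part'[THEN bead_set_beads]])
          (auto simp: charge_beads part part')
      then show ?thesis using beads_inject part part' by (metis prod_eqI)
    qed
    then show "is_core s (0, int a) bp" using bp False unfolding is_core_def by auto
  qed
qed

subsection \<open>Counting simultaneously linked pairs\<close>

text \<open>Only the difference of the charges is fixed, which makes the set invariant under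
  translation.\<close>

definition linked_pairs :: "nat \<Rightarrow> nat \<Rightarrow> nat \<Rightarrow> (int set \<times> int set) set" where
  "linked_pairs s t a = {(X, Y). bead_set X \<and> bead_set Y \<and> charge Y = charge X + int a
    \<and> linked s X Y \<and> linked t X Y}"

lemma card_simultaneous_cores:
  assumes "a < s" "a < t"
  shows "card (cores s (0, int a) \<inter> cores t (0, int a))
    = card {(X, Y) \<in> linked_pairs s t a. charge X = 0}"
proof -
  let ?f = "\<lambda>bp. (beads 0 (fst bp), beads (int a) (snd bp))"
  have bip: "is_bipartition bp" if "is_core s c bp" for bp c using that unfolding is_core_def by blast
  have "bij_betw ?f (cores s (0, int a) \<inter> cores t (0, int a))
    {(X, Y) \<in> linked_pairs s t a. charge X = 0}"
  proof (rule bij_betw_imageI)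
    show "inj_on ?f (cores s (0, int a) \<inter> cores t (0, int a))"
      unfolding cores_def
      by (intro inj_onI prod_eqI) (auto dest!: bip simp: is_bipartition_def intro: beads_inject)
    show "?f ` (cores s (0, int a) \<inter> cores t (0, int a))
      = {(X, Y) \<in> linked_pairs s t a. charge X = 0}"
    proof (intro equalityI subsetI)
      fix p assume "p \<in> ?f ` (cores s (0, int a) \<inter> cores t (0, int a))"
      then obtain bp where bp: "p = ?f bp" "is_core s (0, int a) bp" "is_core t (0, int a) bp"
        unfolding cores_def by blast
      then show "p \<in> {(X, Y) \<in> linked_pairs s t a. charge X = 0}"
        using bip[OF bp(2)] is_core_iff_linked[OF assms(1)] is_core_iff_linked[OF assms(2)]
        unfolding linked_pairs_def is_bipartition_def
        by (simp add: bead_set_beads charge_beads is_bipartition_def)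
    next
      fix p assume "p \<in> {(X, Y) \<in> linked_pairs s t a. charge X = 0}"
      then obtain X Y where p: "p = (X, Y)" "bead_set X" "bead_set Y" "charge X = 0"
        "charge Y = int a" "linked s X Y" "linked t X Y" unfolding linked_pairs_def by auto
      then obtain lam mu where lam: "is_partition lam" "beads 0 lam = X"
        and mu: "is_partition mu" "beads (int a) mu = Y"
        using ex_partition_beads[OF p(2)] ex_partition_beads[OF p(3)] by auto
      then have "is_bipartition (lam, mu)" unfolding is_bipartition_def by simp
      then have "(lam, mu) \<in> cores s (0, int a) \<inter> cores t (0, int a)"
        using is_core_iff_linked[OF assms(1)] is_core_iff_linked[OF assms(2)] lam mu p
        unfolding cores_def by simp
      moreover have "p = ?f (lam, mu)" using lam mu p by simp
      ultimately show "p \<in> ?f ` (cores s (0, int a) \<inter> cores t (0, int a))" by blast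
    qed
  qed
  then show ?thesis by (rule bij_betw_same_card)
qed

section \<open>Translations of linked pairs\<close>

definition translate :: "int \<Rightarrow> int set \<Rightarrow> int set" where
  "translate k X = (+) k ` X"

text \<open>Translation by \<open>k\<close> keeps the partition and raises the charge parameter of
  \<open>beads\<close> by \<open>k\<close>.\<close>

lemma
  assumes "bead_set X"
  shows bead_set_translate: "bead_set (translate k X)"
    and charge_translate: "charge (translate k X) = charge X + k"
proof -
  obtain lam where lam: "is_partition lam" "beads (charge X) lam = X"
    using ex_partition_beads[OF assms] by blast
  have "translate k (beads (charge X) lam) = beads (charge X + k) lam"
    unfolding beads_def translate_def by (simp add: image_image algebra_simps)
  then have "translate k X = beads (charge X + k) lam" using lam by simp
  then show "bead_set (translate k X)" "charge (translate k X) = charge X + k"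
    using lam(1) by (simp_all add: bead_set_beads charge_beads)
qed

lemma mem_translate_iff: "x \<in> translate k X \<longleftrightarrow> x - k \<in> X"
  unfolding translate_def by (auto simp: image_iff algebra_simps intro: bexI[of _ "x - k"])

lemma translate_0 [simp]: "translate 0 X = X"
  unfolding translate_def by simp

lemma linked_translate: "linked s X Y \<Longrightarrow> linked s (translate k X) (translate k Y)"
  unfolding linked_def
  by (auto simp: mem_translate_iff cancel_ab_semigroup_add_class.diff_right_commute[of _ "int s" k])

lemma linked_pairs_translate:
  "(X, Y) \<in> linked_pairs s t a \<Longrightarrow> (translate k X, translate k Y) \<in> linked_pairs s t a"
  unfolding linked_pairs_def
  by (auto simp: bead_set_translate charge_translate linked_translate)

lemma translate_translate: "translate j (translate k X) = translate (j + k) X"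
  unfolding translate_def by (simp add: image_image add.assoc)

text \<open>
  Translations by multiples of \<open>s\<close> have two fundamental domains on the linked pairs: \<open>0\<close> is the
  topmost multiple of \<open>s\<close> in \<open>Y\<close>, or the charge of \<open>X\<close> lies in \<open>{0..<s}\<close>.
\<close>
lemma card_normalised_pairs:
  assumes s: "s > 0"
  shows "card {(X, Y) \<in> linked_pairs s t a. 0 \<in> Y \<and> int s \<notin> Y}
    = s * card {(X, Y) \<in> linked_pairs s t a. charge X = 0}"
proof -
  let ?D = "{(X, Y) \<in> linked_pairs s t a. 0 \<in> Y \<and> int s \<notin> Y}"
  let ?Q = "{(X, Y) \<in> linked_pairs s t a. charge X = 0}"
  \<comment> \<open>A pair is recorded by its charge modulo \<open>s\<close> and its translate of
    charge 0.\<close>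
  let ?f = "\<lambda>(X, Y). (charge X mod int s, translate (- charge X) X, translate (- charge X) Y)"
  have "bij_betw ?f ?D ({0..<int s} \<times> ?Q)"
  proof (rule bij_betw_imageI)
    show "inj_on ?f ?D"
    proof (intro inj_onI)
      fix p q assume "p \<in> ?D" "q \<in> ?D" and eq: "?f p = ?f q"
      then obtain X Y X' Y' where p: "p = (X, Y)" "q = (X', Y')"
        and X: "bead_set X" "linked s X Y" "0 \<in> Y" "int s \<notin> Y"
        and X': "bead_set X'" "linked s X' Y'" "0 \<in> Y'" "int s \<notin> Y'"
        unfolding linked_pairs_def by auto
      define k where "k = charge X' - charge X"
      have "translate (- charge X) X = translate (- charge X') X'"
        "translate (- charge X) Y = translate (- charge X') Y'" using eq p by auto
      then have "translate (charge X') (translate (- charge X) X)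
          = translate (charge X') (translate (- charge X') X')"
        "translate (charge X') (translate (- charge X) Y)
          = translate (charge X') (translate (- charge X') Y')" by simp_all
      then have X'k: "translate k X = X'" and Y'k: "translate k Y = Y'"
        unfolding translate_translate k_def by simp_all
      have dvd: "int s dvd k" using eq p unfolding k_def by (simp add: mod_eq_dvd_iff dvd_diff_commute)
      \<comment> \<open>In both pairs 0 is the topmost multiple of \<open>s\<close>. Translating one
        0 into the other pair gives the beads \<open>- k\<close> and \<open>k\<close>, so neither
        can be positive.\<close>
      have "- k \<in> Y" using X'(3) unfolding Y'k[symmetric] mem_translate_iff by simp
      then have "- k \<le> 0" using linked_le_top[OF X(2) s, of 0 "- k"] X(4) dvd by simp
      moreover have "k \<in> Y'" using X(3) unfolding Y'k[symmetric] mem_translate_iff by simp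
      then have "k \<le> 0" using linked_le_top[OF X'(2) s, of 0 k] X'(4) dvd by simp
      ultimately have "k = 0" by simp
      then show "p = q" using p X'k Y'k by simp
    qed
    show "?f ` ?D = {0..<int s} \<times> ?Q"
    proof (intro equalityI subsetI)
      fix v assume "v \<in> ?f ` ?D"
      then obtain X Y where X: "(X, Y) \<in> linked_pairs s t a"
        and v: "v = (charge X mod int s, translate (- charge X) X, translate (- charge X) Y)" by auto
      have "bead_set X" using X unfolding linked_pairs_def by simp
      then have "charge (translate (- charge X) X) = 0" by (simp add: charge_translate)
      then show "v \<in> {0..<int s} \<times> ?Q" using v s linked_pairs_translate[OF X] by simp
    next
      fix v assume "v \<in> {0..<int s} \<times> ?Q"
      then obtain j X Y where v: "v = (j, X, Y)" and j: "0 \<le> j" "j < int s"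
        and X: "(X, Y) \<in> linked_pairs s t a" "charge X = 0" by auto
      have bs: "bead_set X" "bead_set Y" using X unfolding linked_pairs_def by simp_all
      \<comment> \<open>The topmost bead on the runner of \<open>- j\<close>: moving it to 0 makes
        the charge of \<open>X\<close> equal to \<open>- y\<close>, which is congruent to
        \<open>j\<close>.\<close>
      obtain y where y: "y \<in> Y" "y + int s \<notin> Y" "int s dvd y - (- j)"
        using ex_top_bead[OF bs(2) s] by blast
      have ch: "charge (translate (- y) X) = - y" using bs X by (simp add: charge_translate)
      have "- y mod int s = j mod int s"
        using y(3) by (simp add: mod_eq_dvd_iff) (metis dvd_minus_iff minus_add_distrib diff_conv_add_uminus)
      then have "- y mod int s = j" using j by simp
      then have "v = ?f (translate (- y) X, translate (- y) Y)"
        unfolding v by (simp add: ch translate_translate)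
      moreover have "(translate (- y) X, translate (- y) Y) \<in> ?D"
        using linked_pairs_translate[OF X(1)] y by (simp add: mem_translate_iff add.commute)
      ultimately show "v \<in> ?f ` ?D" by blast
    qed
  qed
  then have "card ?D = card ({0..<int s} \<times> ?Q)" by (rule bij_betw_same_card)
  then show ?thesis by (simp add: card_cartesian_product)
qed

section \<open>Coding normalised pairs by a set of runners and a list of gaps\<close>

lemma ex_residue_index:
  assumes "coprime s t" "s > 0"
  shows "\<exists>j<s. int s dvd x - int j * int t"
proof -
  obtain u v where uv: "u * int s + v * int t = 1"
    using assms bezout_int[of "int s" "int t"] by auto
  \<comment> \<open>By the Bezout identity \<open>v\<close> inverts \<open>t\<close> modulo
    \<open>s\<close>.\<close>
  define j where "j = nat ((x * v) mod int s)"
  have j: "int j = (x * v) mod int s" "j < s" using assms unfolding j_def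
    by (simp_all add: nat_less_iff)
  have "x - x * v * int t = x * u * int s"
    using arg_cong[OF uv, of "(*) x"] by (simp add: algebra_simps)
  then have "x - int j * int t = x * u * int s + (x * v - (x * v) mod int s) * int t"
    unfolding j by (simp add: algebra_simps)
  also have "int s dvd \<dots>" by (intro dvd_add dvd_mult2[OF dvd_minus_mod]) simp
  finally show ?thesis using j by blast
qed

lemma residue_index_unique:
  assumes "coprime s t" "i < s" "j < s" "int s dvd int i * int t - int j * int t"
  shows "i = j"
proof -
  have "int s dvd (int i - int j) * int t" using assms by (simp add: left_diff_distrib)
  then have "int s dvd int i - int j" using assms(1) by (simp add: coprime_dvd_mult_left_iff)
  then have "int i mod int s = int j mod int s" by (simp add: mod_eq_dvd_iff)
  then show ?thesis using assms by simp
qed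

text \<open>
  The runners are numbered so that runner \<open>j\<close> carries the integers congruent to \<open>j t\<close> modulo \<open>s\<close>;
  subtracting \<open>t\<close> then leads from runner \<open>j + 1\<close> to runner \<open>j\<close>.
\<close>
primrec top_bead :: "nat \<Rightarrow> nat \<Rightarrow> nat set \<Rightarrow> nat list \<Rightarrow> nat \<Rightarrow> int" where
  "top_bead s t A l 0 = 0"
| "top_bead s t A l (Suc j)
    = top_bead s t A l j + int t - int s * (int (l ! j) + of_bool (j \<in> A))"

definition upper_beads :: "nat \<Rightarrow> nat \<Rightarrow> nat set \<Rightarrow> nat list \<Rightarrow> int set" where
  "upper_beads s t A l
    = {x. \<exists>j<s. int s dvd x - top_bead s t A l j \<and> x \<le> top_bead s t A l j}"

definition pair_of_gaps :: "nat \<Rightarrow> nat \<Rightarrow> nat set \<times> nat list \<Rightarrow> int set \<times> int set" where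
  "pair_of_gaps s t = (\<lambda>(A, l).
    (upper_beads s t A l - top_bead s t A l ` A, upper_beads s t A l))"

lemma top_bead_eq_sum:
  "top_bead s t A l j = int j * int t - int s * (\<Sum>i<j. int (l ! i) + of_bool (i \<in> A))"
  by (induction j) (simp_all add: algebra_simps)

text \<open>Index \<open>s\<close> stands for runner 0 again: \<open>s\<close> steps up by
  \<open>t\<close> are balanced by \<open>t\<close> subtractions of \<open>s\<close>, so the cycle
  closes.\<close>

lemma top_bead_last:
  assumes "A \<subseteq> {..<s}" "length l = s" "sum_list l + card A = t"
  shows "top_bead s t A l s = 0"
proof -
  have "(\<Sum>i<s. int (l ! i) + of_bool (i \<in> A)) = int (sum_list l) + int (card A)"
    using assms by (simp add: sum.distrib sum_list_sum_nth atLeast0LessThan Int_absorb1 Collect_mem_eq)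
  then show ?thesis using assms unfolding top_bead_eq_sum by (simp flip: of_nat_add)
qed

lemma dvd_top_bead: "int s dvd top_bead s t A l j - int j * int t"
  unfolding top_bead_eq_sum by simp

lemma ex_top_bead_index:
  assumes "coprime s t" "s > 0"
  shows "\<exists>j<s. int s dvd x - top_bead s t A l j"
proof -
  obtain j where j: "j < s" "int s dvd x - int j * int t" using ex_residue_index[OF assms] by blast
  have "int s dvd (x - int j * int t) - (top_bead s t A l j - int j * int t)"
    using j(2) dvd_top_bead by (rule dvd_diff)
  then show ?thesis using j by auto
qed

text \<open>The numbering of the runners does not depend on the gap data, so two different codes can
  be compared.\<close>

lemma top_bead_index_unique:
  assumes "coprime s t" "i < s" "j < s"
    and "int s dvd x - top_bead s t A l i" "int s dvd x - top_bead s t A' l' j"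
  shows "i = j"
proof -
  have "int s dvd (top_bead s t A' l' j - int j * int t) - (top_bead s t A l i - int i * int t)
      + ((x - top_bead s t A' l' j) - (x - top_bead s t A l i))"
    by (rule dvd_add[OF dvd_diff[OF dvd_top_bead dvd_top_bead] dvd_diff[OF assms(5,4)]])
  then show ?thesis using residue_index_unique[OF assms(1-3)] by (simp add: algebra_simps)
qed

lemma mem_upper_beads_iff:
  assumes "coprime s t" "j < s" "int s dvd x - top_bead s t A l j"
  shows "x \<in> upper_beads s t A l \<longleftrightarrow> x \<le> top_bead s t A l j"
  unfolding upper_beads_def using assms top_bead_index_unique[OF assms(1) _ assms(2) _ assms(3)] by blast

lemma top_bead_mem: "j < s \<Longrightarrow> top_bead s t A l j \<in> upper_beads s t A l"
  unfolding upper_beads_def by auto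

lemma inj_on_top_bead: "coprime s t \<Longrightarrow> inj_on (top_bead s t A l) {..<s}"
  by (intro inj_onI) (metis top_bead_index_unique lessThan_iff diff_self dvd_0_right)

lemma pair_of_gaps_mem:
  assumes cop: "coprime s t" and s: "s > 0"
    and A: "A \<subseteq> {..<s}" "card A = a" and l: "length l = s" "sum_list l + a = t"
  shows "pair_of_gaps s t (A, l) \<in> {(X, Y) \<in> linked_pairs s t a. 0 \<in> Y \<and> int s \<notin> Y}"
proof -
  let ?\<tau> = "top_bead s t A l" and ?Y = "upper_beads s t A l"
  let ?X = "?Y - ?\<tau> ` A"
  have idx: "\<exists>j<s. int s dvd x - ?\<tau> j" for x by (rule ex_top_bead_index[OF cop s])
  note mem = mem_upper_beads_iff[OF cop, of _ _ A l]
  have \<tau>s: "?\<tau> s = 0" using top_bead_last A l by blast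
  have \<tau>A: "?\<tau> ` A \<subseteq> ?Y" using A top_bead_mem by blast
  have finT: "finite (?\<tau> ` {..<s})" by simp
  define lo where "lo = Min (?\<tau> ` {..<s})"
  define hi where "hi = Max (?\<tau> ` {..<s})"
  have lo: "lo \<le> ?\<tau> j" and hi: "?\<tau> j \<le> hi" if "j < s" for j
    using that finT unfolding lo_def hi_def by auto
  have "x \<in> ?Y" "x \<notin> ?\<tau> ` A" if "x < lo" for x
  proof -
    obtain j where j: "j < s" "int s dvd x - ?\<tau> j" using idx by blast
    then show "x \<in> ?Y" using mem[OF j] lo[of j] that by simp
    show "x \<notin> ?\<tau> ` A" using that A lo by fastforce
  qed
  then have "{..<lo} \<subseteq> ?X" "{..<lo} \<subseteq> ?Y" by auto
  moreover have "?Y \<subseteq> {..<hi + 1}" unfolding upper_beads_def using hi by fastforce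
  ultimately have bs: "bead_set ?X" "bead_set ?Y" unfolding bead_set_def by blast+
  have "?Y - ?X = ?\<tau> ` A" using \<tau>A by blast
  moreover have "card (?\<tau> ` A) = a"
    using A inj_on_subset[OF inj_on_top_bead[OF cop]] by (metis card_image)
  moreover have "card (?X - ?Y) = 0" by (metis Diff_subset Diff_eq_empty_iff card.empty)
  ultimately have charge: "charge ?Y = charge ?X + int a"
    using dev_diff[OF bs, of "\<lambda>_. 1"] by simp
  have "y - int s \<in> ?X" if y: "y \<in> ?Y" for y
  proof -
    obtain j where j: "j < s" "int s dvd y - ?\<tau> j" "y \<le> ?\<tau> j"
      using y unfolding upper_beads_def by blast
    have dvd: "int s dvd (y - int s) - ?\<tau> j"
      using dvd_diff[OF j(2) dvd_refl] by (simp only: diff_diff_eq add.commute)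
    have "y - int s \<noteq> ?\<tau> i" if "i \<in> A" for i
    proof
      assume eq: "y - int s = ?\<tau> i"
      then have "i = j" using top_bead_index_unique[OF cop _ j(1) _ dvd, of i A l] that A by auto
      then show False using eq j(3) s by simp
    qed
    then show ?thesis using mem[OF j(1) dvd] j(3) by auto
  qed
  then have lnk_s: "linked s ?X ?Y" unfolding linked_def by blast
  have "y - int t \<in> ?X" if y: "y \<in> ?Y" for y
  proof -
    obtain j where j: "j < s" "int s dvd y - ?\<tau> j" "y \<le> ?\<tau> j"
      using y unfolding upper_beads_def by blast
    \<comment> \<open>The cyclic predecessor of \<open>j\<close>: for \<open>j = 0\<close> it is
      \<open>s - 1\<close>, as \<open>?\<tau>\<close> vanishes at both \<open>s\<close> and
      0.\<close>
    obtain i where i: "i < s" "?\<tau> (Suc i) = ?\<tau> j"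
    proof (cases j)
      case 0
      then show ?thesis using that[of "s - 1"] s \<tau>s by simp
    next
      case (Suc k)
      then show ?thesis using that[of k] j(1) by (metis Suc_lessD)
    qed
    then have \<tau>j: "?\<tau> j = ?\<tau> i + int t - int s * (int (l ! i) + of_bool (i \<in> A))" by simp
    have "int s dvd (y - ?\<tau> j) - int s * (int (l ! i) + of_bool (i \<in> A))"
      using j(2) by (rule dvd_diff) simp
    then have dvd: "int s dvd (y - int t) - ?\<tau> i" unfolding \<tau>j by (simp add: algebra_simps)
    have "0 \<le> int s * int (l ! i)" by simp
    \<comment> \<open>A non-negative gap keeps \<open>y - t\<close> at or below the top of runner
      \<open>i\<close>; for \<open>i \<in> A\<close> the extra \<open>s\<close> puts it strictly
      below the removed top.\<close>
    then have le: "y - int t \<le> ?\<tau> i - int s * of_bool (i \<in> A)"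
      using j(3) unfolding \<tau>j distrib_left by linarith
    have "y - int t \<noteq> ?\<tau> k" if "k \<in> A" for k
    proof
      assume eq: "y - int t = ?\<tau> k"
      then have "k = i" using top_bead_index_unique[OF cop _ i(1) _ dvd, of k A l] that A by auto
      then have "y - int t < ?\<tau> i" using le that s by simp
      then show False using eq \<open>k = i\<close> by simp
    qed
    moreover have "y - int t \<le> ?\<tau> i" using le by (cases "i \<in> A") simp_all
    ultimately show ?thesis using mem[OF i(1) dvd] by auto
  qed
  then have lnk_t: "linked t ?X ?Y" unfolding linked_def by blast
  have "0 \<in> ?Y" using top_bead_mem[OF s, of t A l] by simp
  moreover have "int s \<notin> ?Y" using mem[of 0 "int s"] s by simp
  ultimately show ?thesis
    using bs charge lnk_s lnk_t unfolding pair_of_gaps_def linked_pairs_def by simp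
qed

text \<open>The tops are the greatest elements of \<open>Y\<close> on the runners, \<open>A\<close>
  is read off from the tops missing in \<open>X\<close>, and \<open>l\<close> from differences of
  consecutive tops.\<close>

lemma inj_on_pair_of_gaps:
  assumes cop: "coprime s t" and s: "s > 0"
  shows "inj_on (pair_of_gaps s t)
    ({A. A \<subseteq> {..<s} \<and> card A = a} \<times> {l. length l = s \<and> sum_list l + a = t})"
proof (intro inj_onI)
  fix p q
  assume "p \<in> {A. A \<subseteq> {..<s} \<and> card A = a} \<times> {l. length l = s \<and> sum_list l + a = t}"
    and "q \<in> {A. A \<subseteq> {..<s} \<and> card A = a} \<times> {l. length l = s \<and> sum_list l + a = t}"
    and eq: "pair_of_gaps s t p = pair_of_gaps s t q"
  then obtain A l B m where p: "p = (A, l)" "q = (B, m)"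
    and A: "A \<subseteq> {..<s}" "card A = a" "length l = s" "sum_list l + a = t"
    and B: "B \<subseteq> {..<s}" "card B = a" "length m = s" "sum_list m + a = t" by auto
  let ?\<tau> = "top_bead s t A l" and ?\<sigma> = "top_bead s t B m"
  have Y: "upper_beads s t A l = upper_beads s t B m"
    and X: "upper_beads s t A l - ?\<tau> ` A = upper_beads s t B m - ?\<sigma> ` B"
    using eq p unfolding pair_of_gaps_def by auto
  have le: "top_bead s t A l j \<le> top_bead s t B m j"
    if "j < s" "upper_beads s t A l = upper_beads s t B m" for A B l m j
  proof -
    have "top_bead s t A l j \<in> upper_beads s t B m" using top_bead_mem that by metis
    then obtain i where "i < s" "int s dvd top_bead s t A l j - top_bead s t B m i"
      "top_bead s t A l j \<le> top_bead s t B m i" unfolding upper_beads_def by blast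
    then show ?thesis using top_bead_index_unique[OF cop that(1), of i "top_bead s t A l j" A l B m] by simp
  qed
  have eq_lt: "?\<tau> j = ?\<sigma> j" if "j < s" for j
    using le[OF that Y] le[OF that Y[symmetric]] by simp
  \<comment> \<open>Index \<open>s\<close> is included because the last gap belongs to the step from
    \<open>s - 1\<close> to \<open>s\<close>.\<close>
  then have eq_le: "?\<tau> j = ?\<sigma> j" if "j \<le> s" for j
    using that top_bead_last A B by (cases "j = s") auto
  have "?\<tau> ` A = ?\<sigma> ` B"
  proof -
    have "?\<tau> ` A \<subseteq> upper_beads s t A l" "?\<sigma> ` B \<subseteq> upper_beads s t A l"
      using A B top_bead_mem Y by blast+
    then show ?thesis using X Y by blast
  qed
  also have "?\<sigma> ` B = ?\<tau> ` B" using eq_lt B by (intro image_cong) auto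
  finally have AB: "A = B" using inj_on_image_eq_iff[OF inj_on_top_bead[OF cop]] A B by blast
  have "l = m"
  proof (rule nth_equalityI)
    fix j assume "j < length l"
    then have "Suc j \<le> s" "j \<le> s" using A by auto
    then have "?\<tau> (Suc j) = ?\<sigma> (Suc j)" "?\<tau> j = ?\<sigma> j" using eq_le by blast+
    then show "l ! j = m ! j" using AB s by simp
  qed (use A B in simp)
  then show "p = q" using p AB by simp
qed

text \<open>The code is read off from the tops of \<open>Y\<close>: linkage for \<open>t\<close>
  makes the gaps non-negative, and the closing of the cycle gives their sum.\<close>

lemma pair_of_gaps_surj:
  assumes cop: "coprime s t" and s: "s > 0"
    and XY: "(X, Y) \<in> linked_pairs s t a" and Y0: "0 \<in> Y" "int s \<notin> Y"
  shows "\<exists>A l. A \<subseteq> {..<s} \<and> card A = a \<and> length l = s \<and> sum_list l + a = t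
    \<and> pair_of_gaps s t (A, l) = (X, Y)"
proof -
  have bs: "bead_set X" "bead_set Y" and charge: "charge Y = charge X + int a"
    and lnk: "linked s X Y" "linked t X Y" using XY unfolding linked_pairs_def by auto
  obtain top where top: "\<And>x. top x \<in> Y" "\<And>x. top x + int s \<notin> Y" "\<And>x. int s dvd top x - x"
    using ex_top_bead[OF bs(2) s] by metis
  define \<tau> where "\<tau> j = top (int j * int t)" for j
  note le_top = linked_le_top[OF lnk(1) s]
  have \<tau>: "\<tau> j \<in> Y" "\<tau> j + int s \<notin> Y" "int s dvd \<tau> j - int j * int t" for j
    unfolding \<tau>_def using top by auto
  \<comment> \<open>0 is the topmost multiple of \<open>s\<close> in \<open>Y\<close>; this settles
    both ends of the cycle, \<open>j = 0\<close> and \<open>j = s\<close>.\<close>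
  have zero: "\<tau> j = 0" if "int s dvd \<tau> j" for j
    using le_top[OF \<tau>(2) Y0(1), of j] le_top[of 0, OF _ \<tau>(1), of j] Y0 that by simp
  have \<tau>0: "\<tau> 0 = 0" using zero[of 0] \<tau>(3)[of 0] by simp
  have \<tau>s: "\<tau> s = 0" using zero[of s] \<tau>(3)[of s] by (metis dvd_add dvd_triv_left diff_add_cancel)
  have inj: "inj_on \<tau> {..<s}"
  proof (intro inj_onI)
    fix i j assume "i \<in> {..<s}" "j \<in> {..<s}" "\<tau> i = \<tau> j"
    moreover have "int s dvd (\<tau> j - int j * int t) - (\<tau> i - int i * int t)"
      by (rule dvd_diff[OF \<tau>(3) \<tau>(3)])
    ultimately show "i = j" using residue_index_unique[OF cop, of i j] by simp
  qed
  have idx: "\<exists>j<s. int s dvd \<tau> j - x" for x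
  proof -
    obtain j where j: "j < s" "int s dvd x - int j * int t" using ex_residue_index[OF cop s] by blast
    have "int s dvd (\<tau> j - int j * int t) - (x - int j * int t)" using \<tau>(3) j(2) by (rule dvd_diff)
    then show ?thesis using j by auto
  qed
  define A where "A = {j. j < s \<and> \<tau> j \<notin> X}"
  define z where "z j = (\<tau> j + int t - \<tau> (Suc j)) div int s" for j
  \<comment> \<open>\<open>\<tau> (Suc j) - t\<close> is in \<open>X\<close> and on runner
    \<open>j\<close>, hence at most \<open>\<tau> j\<close>. Equality is impossible if
    \<open>\<tau> j\<close> is missing from \<open>X\<close>, so then \<open>z j\<close> is at least
    1.\<close>
  have z: "int s * z j = \<tau> j + int t - \<tau> (Suc j)" and z_ge: "z j \<ge> of_bool (j \<in> A)" for j
  proof -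
    have "int s dvd (\<tau> j - int j * int t) - (\<tau> (Suc j) - int (Suc j) * int t)"
      by (rule dvd_diff[OF \<tau>(3) \<tau>(3)])
    then have dvd: "int s dvd \<tau> j + int t - \<tau> (Suc j)" by (simp add: algebra_simps)
    then show z: "int s * z j = \<tau> j + int t - \<tau> (Suc j)" unfolding z_def by simp
    have x: "\<tau> (Suc j) - int t \<in> X" using \<tau>(1) lnk(2) unfolding linked_def by blast
    then have "\<tau> (Suc j) - int t \<in> Y" using lnk(2) unfolding linked_def by blast
    then have "\<tau> (Suc j) - int t \<le> \<tau> j"
      using le_top[OF \<tau>(2)[of j]] dvd by (simp add: diff_diff_eq2 add.commute)
    then have "z j \<ge> 0" using z s zero_le_mult_iff[of "int s" "z j"] by simp
    moreover have "z j \<noteq> 0" if "j \<in> A"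
    proof
      assume "z j = 0"
      then have "\<tau> (Suc j) - int t = \<tau> j" using z by simp
      then show False using x that unfolding A_def by simp
    qed
    ultimately show "z j \<ge> of_bool (j \<in> A)" by (cases "j \<in> A") force+
  qed
  define l where "l = map (\<lambda>j. nat (z j - of_bool (j \<in> A))) [0..<s]"
  have l: "int (l ! j) + of_bool (j \<in> A) = z j" if "j < s" for j
    using that z_ge[of j] unfolding l_def by simp
  have eq: "top_bead s t A l j = \<tau> j" if "j \<le> s" for j
    using that
  proof (induction j)
    case (Suc j)
    then show ?case using l[of j] z[of j] by simp
  qed (simp add: \<tau>0)
  have Y: "upper_beads s t A l = Y"
  proof (intro equalityI subsetI)
    fix x assume "x \<in> upper_beads s t A l"
    then obtain j where "j < s" "int s dvd x - \<tau> j" "x \<le> \<tau> j"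
      unfolding upper_beads_def using eq by auto
    then show "x \<in> Y" using linked_below(2)[OF lnk(1) s \<tau>(1)[of j]] by (simp add: dvd_diff_commute)
  next
    fix x assume x: "x \<in> Y"
    obtain j where j: "j < s" "int s dvd \<tau> j - x" using idx by blast
    then have "x \<le> \<tau> j" using le_top[OF \<tau>(2) x] by blast
    then show "x \<in> upper_beads s t A l"
      unfolding upper_beads_def using j eq[of j] by (auto simp: dvd_diff_commute)
  qed
  have \<tau>A: "top_bead s t A l ` A = \<tau> ` A" using eq by (intro image_cong) (auto simp: A_def)
  have X: "X = Y - \<tau> ` A"
  proof (intro equalityI subsetI)
    fix x assume "x \<in> X"
    then show "x \<in> Y - \<tau> ` A" using lnk(1) unfolding linked_def A_def by auto
  next
    fix x assume x: "x \<in> Y - \<tau> ` A"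
    obtain j where j: "j < s" "int s dvd \<tau> j - x" using idx by blast
    then have "x \<le> \<tau> j" using le_top[OF \<tau>(2)] x by blast
    then consider "x < \<tau> j" | "x = \<tau> j" by linarith
    then show "x \<in> X"
    proof cases
      case 1
      then show ?thesis using linked_below(1)[OF lnk(1) s \<tau>(1) j(2)] by blast
    next
      case 2
      then show ?thesis using x j(1) unfolding A_def by auto
    qed
  qed
  have As: "A \<subseteq> {..<s}" unfolding A_def by auto
  have cardA: "card A = a"
  proof -
    have "Y - X = \<tau> ` A" using X \<tau>(1) by blast
    moreover have "card (X - Y) = 0" using X by (metis Diff_subset Diff_eq_empty_iff card.empty)
    moreover have "card (\<tau> ` A) = card A" using inj_on_subset[OF inj As] by (rule card_image)
    ultimately show ?thesis using dev_diff[OF bs, of "\<lambda>_. 1"] charge by simp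
  qed
  have "int (sum_list l) + int a = (\<Sum>j<s. int (l ! j) + of_bool (j \<in> A))"
    using As cardA by (simp add: sum.distrib sum_list_sum_nth atLeast0LessThan l_def Int_absorb1)
  \<comment> \<open>The closed form of \<open>top_bead\<close> at index \<open>s\<close>, where it
    vanishes, gives the total of the gaps and \<open>card A\<close>.\<close>
  moreover have "int s * int t = int s * (\<Sum>j<s. int (l ! j) + of_bool (j \<in> A))"
    using eq[of s] \<tau>s unfolding top_bead_eq_sum by simp
  ultimately have "sum_list l + a = t" using s by simp
  moreover have "length l = s" unfolding l_def by simp
  moreover have "pair_of_gaps s t (A, l) = (X, Y)"
    unfolding pair_of_gaps_def by (simp add: Y \<tau>A X[symmetric])
  ultimately show ?thesis using As cardA by blast
qed

lemma card_normalised_pairs_eq_binomial: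
  assumes "coprime s t" "s > 0" "a \<le> t"
  shows "card {(X, Y) \<in> linked_pairs s t a. 0 \<in> Y \<and> int s \<notin> Y}
    = (s choose a) * ((t - a + s - 1) choose (t - a))"
proof -
  let ?G = "{A. A \<subseteq> {..<s} \<and> card A = a} \<times> {l. length l = s \<and> sum_list l + a = t}"
  let ?D = "{(X, Y) \<in> linked_pairs s t a. 0 \<in> Y \<and> int s \<notin> Y}"
  have "bij_betw (pair_of_gaps s t) ?G ?D"
  proof (rule bij_betw_imageI[OF inj_on_pair_of_gaps[OF assms(1,2)]])
    show "pair_of_gaps s t ` ?G = ?D"
    proof (intro equalityI subsetI)
      fix p assume "p \<in> pair_of_gaps s t ` ?G"
      then obtain A l where "p = pair_of_gaps s t (A, l)" "A \<subseteq> {..<s}" "card A = a"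
        "length l = s" "sum_list l + a = t" by auto
      then show "p \<in> ?D" using pair_of_gaps_mem[OF assms(1,2)] by simp
    next
      fix p assume "p \<in> ?D"
      then obtain X Y where p: "p = (X, Y)" "(X, Y) \<in> linked_pairs s t a" "0 \<in> Y" "int s \<notin> Y"
        by (cases p) simp
      then obtain A l where Al: "(A, l) \<in> ?G" "pair_of_gaps s t (A, l) = p"
        using pair_of_gaps_surj[OF assms(1,2) p(2-4)] by blast
      show "p \<in> pair_of_gaps s t ` ?G"
        unfolding Al(2)[symmetric] using Al(1) by (rule imageI)
    qed
  qed
  then have "card ?D = card ?G" by (rule bij_betw_same_card[symmetric])
  also have "\<dots> = (s choose a) * card {l :: nat list. length l = s \<and> sum_list l + a = t}"
    using n_subsets[of "{..<s}" a] by (simp add: card_cartesian_product)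
  also have "{l :: nat list. length l = s \<and> sum_list l + a = t}
      = {l. length l = s \<and> sum_list l = t - a}" using assms(3) by auto
  also have "card \<dots> = (t - a + s - 1) choose (t - a)" by (rule card_length_sum_list)
  finally show ?thesis .
qed

theorem theorem4p7:
  fixes a s t :: nat
  assumes "a < s" and "s \<le> t" and "coprime s t"
  shows "real (card (cores s (0, int a) \<inter> cores t (0, int a))) =
         fact (s + t - a - 1) / (fact a * fact (s - a) * fact (t - a))"
proof -
  have le: "a \<le> s" "a \<le> t" "a < t" "0 < s" using assms by auto
  let ?c = "card (cores s (0, int a) \<inter> cores t (0, int a))"
  have "s * ?c = (s choose a) * ((t - a + s - 1) choose (t - a))"
    using card_normalised_pairs[of s t a] card_normalised_pairs_eq_binomial[of s t a]
      card_simultaneous_cores[of a s t] assms le by simp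
  then have "real s * real ?c = real (s choose a) * real ((t - a + s - 1) choose (t - a))"
    by (metis of_nat_mult)
  also have "real (s choose a) = fact s / (fact a * fact (s - a))"
    using le by (simp add: binomial_fact)
  also have "real ((t - a + s - 1) choose (t - a))
      = fact (s + t - a - 1) / (fact (t - a) * fact (s - 1))"
  proof -
    have "t - a + s - 1 = s + t - a - 1" "s + t - a - 1 - (t - a) = s - 1" using le by auto
    then show ?thesis using le by (simp add: binomial_fact)
  qed
  \<comment> \<open>This exposes the factor \<open>s\<close> that cancels the one from the count of
    fundamental domains, and \<open>fact (s - 1)\<close> cancels the denominator.\<close>
  also have "fact s = real s * fact (s - 1)" using le by (simp add: fact_reduce)
  finally show ?thesis using le by (simp add: field_simps)
qed

end
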